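(* For every integer $n\ge 0$, $$\sum_{i=0}^{n}(-2)^{i}L_{3i}=2-(-2)^{n+1}F_{3n},$$ $$4\sum_{i=0}^{n}9^{i}L_{6i}=9^{n+1}F_{6n}+8,$$ $$17\sum_{i=0}^{n}(-38)^{i}L_{9i}=34-(-38)^{n+1}F_{9n}.$$
   Context: $F_n$ denotes the Fibonacci numbers: $F_0=0$, $F_1=1$, $F_n=F_{n-1}+F_{n-2}$. $L_n$ denotes the Lucas numbers: $L_0=2$, $L_1=1$, $L_n=L_{n-1}+L_{n-2}$. *)

theory Defs
  imports "HOL-Number_Theory.Fib"
begin

fun lucas :: "nat \<Rightarrow> nat" where
  "lucas 0 = 2"
| "lucas (Suc 0) = 1"
| "lucas (Suc (Suc n)) = lucas (Suc n) + lucas n"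

end

theory Submission
  imports Defs
begin

text \<open>
  All three identities are one telescoping sum, taken at \<open>k = 3, 6, 9\<close>.  Fibonacci and Lucas numbers
  are two solutions of the same second-order recurrence, so each \<open>L\<^bsub>m+k\<^esub>\<close> is, up to the factor
  \<open>F\<^bsub>k\<^esub>\<close>, a combination of \<open>F\<^bsub>m+k\<^esub>\<close> and \<open>F\<^bsub>m\<^esub>\<close> with coefficients independent of \<open>m\<close>
  (\<open>fib_times_lucas_add\<close>):
  \<open>F\<^bsub>k\<^esub> L\<^bsub>m+k\<^esub> = L\<^bsub>k\<^esub> F\<^bsub>m+k\<^esub> - 2 (-1)\<^sup>k F\<^bsub>m\<^esub>\<close>.
  After multiplying by \<open>x\<close> to the power \<open>i + 1\<close> and putting \<open>m = k i\<close>, the right-hand side is a difference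
  of consecutive terms of the sequence \<open>2 (-1)\<^sup>k x\<^bsup>i+1\<^esup> F\<^bsub>ki\<^esub>\<close> when
  \<open>2 x = (-1)\<^sup>k L\<^bsub>k\<^esub>\<close>.  Since \<open>L\<^bsub>3\<^esub> = 4\<close>, \<open>L\<^bsub>6\<^esub> = 18\<close> and \<open>L\<^bsub>9\<^esub> = 76\<close>, this explains the
  bases \<open>-2\<close>, \<open>9\<close> and \<open>-38\<close>; the factors \<open>4\<close> and \<open>17\<close> are \<open>F\<^bsub>6\<^esub> / 2\<close> and \<open>F\<^bsub>9\<^esub> / 2\<close>.
\<close>

text \<open>The Casoratian of the two solutions changes sign at each step of the recurrence; its initial
  value is \<open>F\<^bsub>0\<^esub> L\<^bsub>1\<^esub> - L\<^bsub>0\<^esub> F\<^bsub>1\<^esub> = -2\<close>.\<close>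

lemma fib_lucas_casoratian:
  "int (fib k) * int (lucas (Suc k)) - int (lucas k) * int (fib (Suc k)) = - 2 * (-1) ^ k"
  by (induction k) (simp_all add: algebra_simps)

text \<open>For fixed \<open>k\<close> both sides satisfy the Fibonacci recurrence in \<open>m\<close>, so it suffices to compare
  them at \<open>m = 0\<close>, where they agree trivially, and at \<open>m = 1\<close>, where their equality is the Casoratian
  identity at \<open>k\<close>.\<close>

lemma fib_times_lucas_add:
  "int (fib k) * int (lucas (m + k)) =
     int (lucas k) * int (fib (m + k)) - 2 * (-1) ^ k * int (fib m)"
proof (induction m rule: fib.induct)
  case 1
  show ?case by simp
next
  case 2
  show ?case using fib_lucas_casoratian[of k] by simp
next
  case (3 m)
  then show ?case by (simp add: algebra_simps)
qed

lemma sum_power_lucas_multiples: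
  fixes x :: int
  assumes x: "2 * x = (-1) ^ k * int (lucas k)"
  shows "int (fib k) * (\<Sum>i=0..n. x ^ i * int (lucas (k * i))) =
           2 * int (fib k) + 2 * (-1) ^ k * x ^ (n + 1) * int (fib (k * n))"
proof (induction n)
  case 0
  show ?case by simp
next
  case (Suc n)
  have lucas_k: "int (lucas k) = 2 * (-1) ^ k * x"
  proof -
    have "2 * (-1) ^ k * x = (-1) ^ k * (2 * x)"
      by simp
    also have "\<dots> = ((-1) ^ k * (-1) ^ k) * int (lucas k)"
      unfolding x by (simp only: mult.assoc)
    also have "\<dots> = int (lucas k)"
      by (simp flip: power_mult_distrib)
    finally show ?thesis ..
  qed
  have "int (fib k) * int (lucas (k * Suc n)) =
          2 * (-1) ^ k * x * int (fib (k * Suc n)) - 2 * (-1) ^ k * int (fib (k * n))"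
    using fib_times_lucas_add[of k "k * n"] by (simp add: lucas_k add.commute)
  then have "int (fib k) * (x ^ Suc n * int (lucas (k * Suc n))) =
      x ^ Suc n * (2 * (-1) ^ k * x * int (fib (k * Suc n)) - 2 * (-1) ^ k * int (fib (k * n)))"
    by (metis mult.left_commute)
  with Suc.IH show ?case
    by (simp add: algebra_simps del: mult_Suc_right)
qed

theorem mainTheorem2:
  fixes n :: nat
  shows "(\<Sum>i=0..n. (-2::int) ^ i * int (lucas (3 * i))) = 2 - (-2) ^ (n + 1) * int (fib (3 * n))
    \<and> 4 * (\<Sum>i=0..n. (9::int) ^ i * int (lucas (6 * i))) = 9 ^ (n + 1) * int (fib (6 * n)) + 8
    \<and> 17 * (\<Sum>i=0..n. (-38::int) ^ i * int (lucas (9 * i))) = 34 - (-38) ^ (n + 1) * int (fib (9 * n))"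
proof -
  have "lucas 3 = 4" "lucas 6 = 18" "lucas 9 = 76" and "fib 3 = 2" "fib 6 = 8" "fib 9 = 34"
    by (simp_all add: numeral_eq_Suc)
  then show ?thesis
    using sum_power_lucas_multiples[of "-2" 3 n] sum_power_lucas_multiples[of 9 6 n]
      sum_power_lucas_multiples[of "-38" 9 n]
    by simp
qed

end
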